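(* Let $e=2.7182\dots$ be the Euler number. Then $$2-e=-1+\cfrac{-1}{-1+\cfrac{2}{-1+\cfrac{-1}{-1+\cfrac{3}{-1+\cfrac{-1}{-1+\cfrac{4}{-1+\ddots}}}}}}$$ and $$e-2=1+\cfrac{1}{-1+\cfrac{-2}{1+\cfrac{1}{-1+\cfrac{-3}{1+\cfrac{1}{-1+\cfrac{-4}{1+\ddots}}}}}}.$$ That is, writing continued fractions as $b_0+\cfrac{a_1}{b_1+\cfrac{a_2}{b_2+\ddots}}$: the number $2-e$ has the expansion with $b_n=-1$ for all $n\ge0$ and $a_{2m-1}=-1$, $a_{2m}=m+1$ for all $m\ge1$; and the number $e-2$ has the expansion with $b_n=(-1)^n$ for all $n\ge0$ and $a_{2m-1}=1$, $a_{2m}=-(m+1)$ for all $m\ge1$.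
   Context: For sequences of numbers $(a_n)_{n\ge1}$ and $(b_n)_{n\ge0}$, the $n$-th convergent $A_n/B_n$ of the (generalized) continued fraction $b_0+\cfrac{a_1}{b_1+\cfrac{a_2}{b_2+\ddots}}$ is its truncation at $a_n/b_n$. The sequences $(A_n)$, $(B_n)$ satisfy $A_n=b_nA_{n-1}+a_nA_{n-2}$ and $B_n=b_nB_{n-1}+a_nB_{n-2}$ for $n\ge1$, with $A_{-1}=1$, $A_0=b_0$, $B_{-1}=0$, $B_0=1$. A number $x$ has this continued fraction expansion (equivalently, $x$ equals the continued fraction) if $\lim_{n\to\infty}A_n/B_n=x$. *)

theory Defs
  imports Complex_Main
begin

(* Numerators A_n and denominators B_n of b_0 + a_1/(b_1 + a_2/(b_2 + ...)).
   The cases n = 1 are the general recurrence with A_{-1} = 1 and B_{-1} = 0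
   substituted. The value a 0 is never used. *)

fun cf_num :: "(nat \<Rightarrow> 'a::comm_ring_1) \<Rightarrow> (nat \<Rightarrow> 'a) \<Rightarrow> nat \<Rightarrow> 'a" where
  "cf_num a b 0 = b 0"
| "cf_num a b (Suc 0) = b 1 * b 0 + a 1"
| "cf_num a b (Suc (Suc n)) =
     b (Suc (Suc n)) * cf_num a b (Suc n) + a (Suc (Suc n)) * cf_num a b n"

fun cf_den :: "(nat \<Rightarrow> 'a::comm_ring_1) \<Rightarrow> (nat \<Rightarrow> 'a) \<Rightarrow> nat \<Rightarrow> 'a" where
  "cf_den a b 0 = 1"
| "cf_den a b (Suc 0) = b 1"
| "cf_den a b (Suc (Suc n)) =
     b (Suc (Suc n)) * cf_den a b (Suc n) + a (Suc (Suc n)) * cf_den a b n"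

(* Convergents are taken as A_n / B_n rather than as literally nested quotients:
   an inner denominator of a truncation may vanish (meaning an inner value of
   infinity) although B_n does not, and x / 0 = 0 would then give a wrong value. *)

definition cf_convergent :: "(nat \<Rightarrow> 'a::field) \<Rightarrow> (nat \<Rightarrow> 'a) \<Rightarrow> nat \<Rightarrow> 'a" where
  "cf_convergent a b n = cf_num a b n / cf_den a b n"

(* The first conjunct ensures that x / 0 = 0 cannot contribute to the limit. *)

definition has_cf_expansion ::
    "'a::real_normed_field \<Rightarrow> (nat \<Rightarrow> 'a) \<Rightarrow> (nat \<Rightarrow> 'a) \<Rightarrow> bool" where
  "has_cf_expansion x a b \<longleftrightarrow>
     (\<forall>\<^sub>F n in sequentially. cf_den a b n \<noteq> 0) \<and> cf_convergent a b \<longlonglongrightarrow> x"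

end

theory Submission
  imports Defs
begin

text \<open>
  Let \<open>D\<close> be the derangement numbers, \<open>D n = n! * (\<Sum>k\<le>n. (-1)^k / k!)\<close>. Both \<open>D n\<close> and \<open>n!\<close>
  satisfy the recurrence \<open>f (n + 2) = (n + 1) * (f (n + 1) + f n)\<close>
  (\<open>subfactorial_rec\<close>). Two steps of the recurrence that defines the numerators and denominators
  of the first continued fraction amount to one step of this one: every such \<open>f\<close> yields a solution
  with the values \<open>f (m + 1) + f (m + 2)\<close> at \<open>2 * m\<close> and \<open>- f (m + 2)\<close> at \<open>2 * m + 1\<close>
  (\<open>interleaved_solution\<close>). The initial values select \<open>f = D\<close> for the denominators and
  \<open>f n = 2 * D n - n!\<close> for the numerators. Hence, with \<open>n = m + 2\<close>, the convergent
  at \<open>2 * m + 1\<close> is \<open>2 - n! / D n\<close>, and the one at \<open>2 * m\<close> is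
  \<open>2 - ((n - 1)! + n!) / (D (n - 1) + D n)\<close>, which involves the mediant of two consecutive fractions
  of the first kind. Since \<open>D n / n!\<close> is a partial sum of the series of \<open>exp (-1)\<close>, both subsequences
  tend to \<open>2 - exp 1\<close>.

  The second continued fraction arises from the first by the equivalence transformation with the
  multipliers \<open>(-1)^(n+1)\<close> (\<open>has_cf_expansion_scale\<close>), which negates the value because the
  multiplier of \<open>b 0\<close> is \<open>-1\<close>.
\<close>

lemma cf_num_scale:
  assumes "\<And>n. d n = r n * b n"
    and "\<And>n. c (Suc n) = r (Suc n) * r n * a (Suc n)"
  shows "cf_num c d n = (\<Prod>i\<le>n. r i) * cf_num a b n"
  by (induction n rule: induct_nat_012) (simp_all add: assms algebra_simps)

lemma cf_den_scale:
  assumes "\<And>n. d n = r n * b n"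
    and "\<And>n. c (Suc n) = r (Suc n) * r n * a (Suc n)"
  shows "cf_den c d n = (\<Prod>i<n. r (Suc i)) * cf_den a b n"
  by (induction n rule: induct_nat_012) (simp_all add: assms algebra_simps)

text \<open>
  The equivalence transformation multiplies numerators and denominators by the same product of
  multipliers, except that \<open>r 0\<close> enters only the numerators.
\<close>

lemma has_cf_expansion_scale:
  assumes x: "has_cf_expansion x a b"
    and r: "\<And>n. r n \<noteq> 0"
    and d: "\<And>n. d n = r n * b n"
    and c: "\<And>n. c (Suc n) = r (Suc n) * r n * a (Suc n)"
  shows "has_cf_expansion (r 0 * x) c d"
proof -
  have den: "cf_den c d n = (\<Prod>i<n. r (Suc i)) * cf_den a b n" for n
    by (rule cf_den_scale[where r = r]) (fact d c)+
  have num: "cf_num c d n = r 0 * (\<Prod>i<n. r (Suc i)) * cf_num a b n" for n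
    by (simp add: cf_num_scale[where r = r, OF d, where a = a, OF c] prod.atMost_shift)
  have nz: "(\<Prod>i<n. r (Suc i)) \<noteq> 0" for n
    using r by simp
  have "cf_convergent c d = (\<lambda>n. r 0 * cf_convergent a b n)"
    using nz by (auto simp: cf_convergent_def den num)
  moreover have "(\<lambda>n. r 0 * cf_convergent a b n) \<longlonglongrightarrow> r 0 * x"
    using x unfolding has_cf_expansion_def by (intro tendsto_mult_left) simp
  ultimately show ?thesis
    using x nz unfolding has_cf_expansion_def den by simp
qed

definition subfactorial :: "nat \<Rightarrow> real" where
  "subfactorial n = fact n * (\<Sum>k\<le>n. (-1) ^ k / fact k)"

lemma subfactorial_Suc: "subfactorial (Suc n) = real (Suc n) * subfactorial n + (-1) ^ Suc n"
  by (simp add: subfactorial_def distrib_left del: power_Suc of_nat_Suc)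

lemma subfactorial_rec:
  "subfactorial (n + 2) = real (n + 1) * (subfactorial (n + 1) + subfactorial n)"
  by (simp add: subfactorial_Suc algebra_simps)

lemma subfactorial_ratio_tendsto: "(\<lambda>n. subfactorial n / fact n) \<longlonglongrightarrow> exp (-1)"
proof -
  have "(\<lambda>k. (-1) ^ k / fact k) sums exp (-1 :: real)"
    using exp_converges[of "-1 :: real"] by (simp add: field_simps)
  thus ?thesis
    by (simp add: sums_def_le subfactorial_def)
qed

text \<open>
  The shift excludes \<open>subfactorial 1 = 0\<close>. Positivity from \<open>2\<close> on keeps all denominators of the
  first continued fraction nonzero.
\<close>

lemma subfactorial_pos: "subfactorial (n + 2) > 0"
proof (induction n rule: induct_nat_012)
  case 0
  show ?case by (simp add: subfactorial_def numeral_2_eq_2)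
next
  case 1
  show ?case by (simp add: subfactorial_def eval_nat_numeral)
next
  case (ge2 n)
  thus ?case using subfactorial_rec[of "n + 2"] by (simp add: numeral_2_eq_2)
qed

lemma subfactorial_nonneg_Suc: "subfactorial (n + 1) \<ge> 0"
  using subfactorial_pos[of "n - 1"] by (cases n) (simp_all add: subfactorial_def)

text \<open>
  The step from \<open>2 * m + 1\<close> to \<open>2 * m + 2\<close> adds \<open>f (m + 2)\<close> to
  \<open>(m + 2) * (f (m + 1) + f (m + 2))\<close>, which the recurrence for \<open>f\<close> collapses to \<open>f (m + 3)\<close>.
  In the following step \<open>f (m + 2)\<close> cancels, which restores the pattern.
\<close>

lemma interleaved_solution:
  fixes a f u :: "nat \<Rightarrow> real"
  assumes a_odd: "\<And>m. a (2 * m + 3) = -1"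
    and a_even: "\<And>m. a (2 * m + 2) = real m + 2"
    and u: "\<And>n. u (n + 2) = - u (n + 1) + a (n + 2) * u n"
    and f: "\<And>n. f (n + 2) = real (n + 1) * (f (n + 1) + f n)"
    and init: "u 0 = f 1 + f 2" "u 1 = - f 2"
  shows "u (2 * m) = f (m + 1) + f (m + 2) \<and> u (2 * m + 1) = - f (m + 2)"
proof (induction m)
  case 0
  show ?case using init by (simp add: numeral_2_eq_2)
next
  case (Suc m)
  have "f (m + 3) = (real m + 2) * (f (m + 2) + f (m + 1))"
    using f[of "m + 1"] by (simp add: eval_nat_numeral)
  hence even: "u (2 * m + 2) = f (m + 2) + f (m + 3)"
    using Suc u[of "2 * m"] a_even[of m] by (simp add: algebra_simps)
  have "u (2 * m + 3) = - f (m + 3)"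
    using Suc u[of "2 * m + 1"] a_odd[of m] even by (simp add: eval_nat_numeral)
  with even show ?case by (simp add: eval_nat_numeral)
qed

text \<open>
  A mediant of two fractions with positive denominators is a weighted mean of them; here the weights
  are \<open>1 / (n + 2)\<close> and \<open>(n + 1) / (n + 2)\<close>, so the limit of the fractions carries over.
\<close>

lemma mediant_subfactorial_tendsto:
  "(\<lambda>n. (subfactorial n + subfactorial (Suc n)) / (fact n + fact (Suc n))) \<longlonglongrightarrow> exp (-1)"
proof -
  define S where "S n = subfactorial n / fact n" for n
  have S: "S \<longlonglongrightarrow> exp (-1)"
    unfolding S_def by (rule subfactorial_ratio_tendsto)
  have Suc_S: "(\<lambda>n. S (Suc n)) \<longlonglongrightarrow> exp (-1)"
    using S by (rule LIMSEQ_Suc)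
  have "(\<lambda>n. S (Suc n) + (S n - S (Suc n)) * inverse (real (n + 2))) \<longlonglongrightarrow>
      exp (-1) + (exp (-1) - exp (-1)) * 0"
    using LIMSEQ_ignore_initial_segment[OF lim_inverse_n, of 2]
    by (intro tendsto_intros S Suc_S) simp
  moreover have "(subfactorial n + subfactorial (Suc n)) / (fact n + fact (Suc n)) =
      S (Suc n) + (S n - S (Suc n)) * inverse (real (n + 2))" for n
  proof -
    have pos: "1 + real (Suc n) > 0"
      by simp
    have "subfactorial n = fact n * S n" "subfactorial (Suc n) = fact n * (real (Suc n) * S (Suc n))"
      by (simp_all add: S_def)
    moreover have "fact n + fact (Suc n) = fact n * (1 + real (Suc n))"
      by (simp add: algebra_simps)
    ultimately have "(subfactorial n + subfactorial (Suc n)) / (fact n + fact (Suc n)) =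
        (S n + real (Suc n) * S (Suc n)) / (1 + real (Suc n))"
      by (simp flip: distrib_left del: of_nat_Suc fact_Suc)
    also have "\<dots> = S (Suc n) + (S n - S (Suc n)) * inverse (real (n + 2))"
      using pos by (simp add: field_simps)
    finally show ?thesis .
  qed
  ultimately show ?thesis by simp
qed

lemma tendsto_even_odd:
  fixes u :: "nat \<Rightarrow> 'a::topological_space"
  assumes "(\<lambda>m. u (2 * m)) \<longlonglongrightarrow> x" "(\<lambda>m. u (2 * m + 1)) \<longlonglongrightarrow> x"
  shows "u \<longlonglongrightarrow> x"
proof (rule topological_tendstoI)
  fix S assume "open S" "x \<in> S"
  then obtain M N where M: "\<And>m. m \<ge> M \<Longrightarrow> u (2 * m) \<in> S" and N: "\<And>m. m \<ge> N \<Longrightarrow> u (2 * m + 1) \<in> S"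
    using assms[THEN topological_tendstoD] unfolding eventually_sequentially by meson
  have "u n \<in> S" if "n \<ge> 2 * (M + N) + 1" for n
    using M[of "n div 2"] N[of "n div 2"] that by (cases "even n") auto
  thus "\<forall>\<^sub>F n in sequentially. u n \<in> S"
    unfolding eventually_sequentially by blast
qed

lemma has_cf_expansion_two_minus_exp_1:
  fixes a b :: "nat \<Rightarrow> real"
  assumes b: "\<And>n. b n = -1"
    and a_odd: "\<And>m. a (2 * m + 1) = -1"
    and a_even: "\<And>m. a (2 * m + 2) = real m + 2"
  shows "has_cf_expansion (2 - exp 1) a b"
proof -
  have a3: "a (2 * m + 3) = -1" for m
    using a_odd[of "m + 1"] by (simp add: eval_nat_numeral)
  have a1: "a (Suc 0) = -1"
    using a_odd[of 0] by simp
  \<comment> \<open>The numerators are this solution since \<open>f 1 + f 2 = -1 = b 0\<close> and \<open>f 2 = 0\<close>.\<close>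
  define f where "f n = 2 * subfactorial n - fact n" for n
  have f: "f (n + 2) = real (n + 1) * (f (n + 1) + f n)" for n
    by (simp add: f_def subfactorial_Suc algebra_simps)
  have small: "subfactorial 1 = 0" "subfactorial 2 = 1"
    by (simp_all add: subfactorial_def eval_nat_numeral)
  have den: "cf_den a b (2 * m) = subfactorial (m + 1) + subfactorial (m + 2) \<and>
      cf_den a b (2 * m + 1) = - subfactorial (m + 2)" for m
    by (rule interleaved_solution[OF a3 a_even _ subfactorial_rec]) (use small in \<open>simp_all add: b\<close>)
  have num: "cf_num a b (2 * m) = f (m + 1) + f (m + 2) \<and>
      cf_num a b (2 * m + 1) = - f (m + 2)" for m
    by (rule interleaved_solution[OF a3 a_even _ f])
      (use small in \<open>simp_all add: b a1 f_def fact_2\<close>)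
  have pos: "subfactorial (m + 2) > 0" "subfactorial (m + 1) + subfactorial (m + 2) > 0" for m
    using subfactorial_pos[of m] subfactorial_nonneg_Suc[of m] by linarith+
  have den_nz: "cf_den a b n \<noteq> 0" for n
    using den[of "n div 2"] pos[of "n div 2"] by (cases "even n") auto
  have exp: "inverse (exp (-1)) = exp (1::real)"
    by (simp add: exp_minus)
  have even: "(\<lambda>m. cf_convergent a b (2 * m)) \<longlonglongrightarrow> 2 - exp 1"
  proof -
    have "(\<lambda>m. 2 - inverse ((subfactorial (m + 1) + subfactorial (Suc (m + 1))) /
        (fact (m + 1) + fact (Suc (m + 1))))) \<longlonglongrightarrow> 2 - inverse (exp (-1))"
      by (intro tendsto_intros LIMSEQ_ignore_initial_segment[OF mediant_subfactorial_tendsto]) simp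
    moreover have "cf_convergent a b (2 * m) =
        2 - inverse ((subfactorial (m + 1) + subfactorial (Suc (m + 1))) /
        (fact (m + 1) + fact (Suc (m + 1))))" for m
      using den[of m] num[of m] pos(2)[of m]
      by (simp add: cf_convergent_def f_def divide_simps)
    ultimately show ?thesis unfolding exp by simp
  qed
  have odd: "(\<lambda>m. cf_convergent a b (2 * m + 1)) \<longlonglongrightarrow> 2 - exp 1"
  proof -
    have "(\<lambda>m. 2 - inverse (subfactorial (m + 2) / fact (m + 2))) \<longlonglongrightarrow> 2 - inverse (exp (-1))"
      by (intro tendsto_intros LIMSEQ_ignore_initial_segment[OF subfactorial_ratio_tendsto]) simp
    moreover have "cf_convergent a b (2 * m + 1) =
        2 - inverse (subfactorial (m + 2) / fact (m + 2))" for m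
      using den[of m] num[of m] pos(1)[of m]
      by (simp add: cf_convergent_def f_def divide_simps)
    ultimately show ?thesis unfolding exp by simp
  qed
  show ?thesis
    unfolding has_cf_expansion_def using den_nz tendsto_even_odd[OF even odd] by simp
qed

theorem corollary3:
  fixes a b c d :: "nat \<Rightarrow> real"
  assumes "\<And>n. b n = -1"
    and "\<And>m. m \<ge> 1 \<Longrightarrow> a (2 * m - 1) = -1"
    and "\<And>m. m \<ge> 1 \<Longrightarrow> a (2 * m) = real m + 1"
    and "\<And>n. d n = (-1) ^ n"
    and "\<And>m. m \<ge> 1 \<Longrightarrow> c (2 * m - 1) = 1"
    and "\<And>m. m \<ge> 1 \<Longrightarrow> c (2 * m) = - (real m + 1)"
  shows "has_cf_expansion (2 - exp 1) a b \<and> has_cf_expansion (exp 1 - 2) c d"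
proof
  have a_odd: "a (2 * m + 1) = -1" and c_odd: "c (2 * m + 1) = 1" for m
    using assms(2)[of "m + 1"] assms(5)[of "m + 1"] by simp_all
  have a_even: "a (2 * m + 2) = real m + 2" and c_even: "c (2 * m + 2) = - (real m + 2)" for m
    using assms(3)[of "m + 1"] assms(6)[of "m + 1"] by simp_all
  show ab: "has_cf_expansion (2 - exp 1) a b"
    using assms(1) a_odd a_even by (rule has_cf_expansion_two_minus_exp_1)
  have neg: "c (Suc n) = - a (Suc n)" for n
    using a_odd[of "n div 2"] c_odd[of "n div 2"] a_even[of "n div 2"] c_even[of "n div 2"]
    by (cases "even n") auto
  have "has_cf_expansion ((-1) ^ Suc 0 * (2 - exp 1)) c d"
    by (rule has_cf_expansion_scale[OF ab, where r = "\<lambda>n. (-1) ^ Suc n"])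
      (simp_all add: assms(1,4) neg flip: power_mult_distrib)
  thus "has_cf_expansion (exp 1 - 2) c d" by simp
qed

end
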